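(* There is a constant $c$ such that, for every $d\ge 2$, every $d$-dimensional vector addition system $A$ and target $t\in\mathbb{N}^d$ whose input size in unary encoding is $n\ge 2$, the backward coverability algorithm terminates after at most $n^{2^{cd}}$ iterations, i.e. the least $\ell$ with $U_\ell=U_{\ell+1}$ satisfies $\ell\le n^{2^{cd}}$ (in short, $\ell\le n^{2^{O(d)}}$).
   Context: A $d$-dimensional vector addition system (VAS) is a finite set $A\subseteq\mathbb{Z}^d$; it defines transitions $u\to u+a$ for $u\in\mathbb{N}^d$, $a\in A$ with $u+a\in\mathbb{N}^d$. Vectors are ordered componentwise by $\sqsubseteq$, and ${\uparrow}S=\{x: \exists y\in S,\ y\sqsubseteq x\}$. The backward coverability algorithm for target $t$ computes $U_0={\uparrow}\{t\}$ and $U_{k+1}=U_k\cup\mathrm{Pre}_\exists(U_k)$ where $\mathrm{Pre}_\exists(S)=\{x\in\mathbb{N}^d:\exists y\in S,\ x\to y\}$; it stops at the first $\ell$ with $U_\ell=U_{\ell+1}$ (the number of iterations). The input is encoded in unary; $n$ denotes its size (in particular $n\ge\max_{a\in A}\max_i|a(i)|$ and $n\ge\max_i t(i)$). *)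

theory Defs
  imports "Jordan_Normal_Form.Matrix"
begin

(* Vectors of length d are the elements of carrier_vec d; the order on vec in
   Jordan_Normal_Form.Matrix is componentwise (on vectors of equal length).
   Vectors in Z^d have type int vec, configurations in N^d have type nat vec. *)

definition vas :: "nat \<Rightarrow> int vec set \<Rightarrow> bool" where
  "vas d A \<longleftrightarrow> finite A \<and> A \<subseteq> carrier_vec d"

definition vas_step :: "nat \<Rightarrow> int vec set \<Rightarrow> nat vec \<Rightarrow> nat vec \<Rightarrow> bool" where
  "vas_step d A u v \<longleftrightarrow> u \<in> carrier_vec d \<and> v \<in> carrier_vec d \<and>
     (\<exists>a\<in>A. map_vec int v = map_vec int u + a)"

definition upward_closure :: "nat \<Rightarrow> nat vec set \<Rightarrow> nat vec set" where
  "upward_closure d S = {x \<in> carrier_vec d. \<exists>y\<in>S. y \<le> x}"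

definition pre_exists :: "nat \<Rightarrow> int vec set \<Rightarrow> nat vec set \<Rightarrow> nat vec set" where
  "pre_exists d A S = {x \<in> carrier_vec d. \<exists>y\<in>S. vas_step d A x y}"

primrec backward_cover :: "nat \<Rightarrow> int vec set \<Rightarrow> nat vec \<Rightarrow> nat \<Rightarrow> nat vec set" where
  "backward_cover d A t 0 = upward_closure d {t}"
| "backward_cover d A t (Suc k) =
     backward_cover d A t k \<union> pre_exists d A (backward_cover d A t k)"

(* Length of the unary encoding in which an integer k is written as a sign symbol
   followed by \<bar>k\<bar> strokes, and a natural number k as k strokes followed by a
   delimiter. Hence each entry k of an action or of the target contributes
   \<bar>k\<bar> + 1 symbols. *)
definition unary_size :: "nat \<Rightarrow> int vec set \<Rightarrow> nat vec \<Rightarrow> nat" where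
  "unary_size d A t =
     (\<Sum>a\<in>A. \<Sum>i<d. nat \<bar>a $ i\<bar> + 1) + (\<Sum>i<d. t $ i + 1)"

end

(* A configuration lies in U_l iff it covers t within l steps, so it suffices to bound the length of
   shortest covering runs. Following Rackoff, only the coordinates in a finite set I are kept
   nonnegative, and the bound L m for card I = m is found by induction on m. Call a configuration thin
   if, for every k < m, more than k of its coordinates in I lie below M k. A configuration that is not
   thin has a set J of at most k small coordinates while the others are at least M k, so large that
   they survive a run of length L k that covers the target on J; hence its distance to the target is
   at most L (m - 1). Along a shortest run all configurations at distance above L (m - 1) are
   therefore thin, and they are pairwise distinct on I. There are at most m! * M 0 * ... * M (m - 1)
   thin configurations, so with M k about n * L k the exponent of n in L merely doubles with every
   dimension. *)

theory Submission
  imports Defs "HOL-Library.FuncSet"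
begin

section \<open>Covering runs that respect only the coordinates in \<open>I\<close>\<close>

text \<open>Configurations are total functions, so forgetting coordinates just shrinks
  \<open>I\<close>. The number of steps is exactly \<open>j\<close>; coordinates outside
  \<open>I\<close> may become negative.\<close>

primrec covers :: "('i \<Rightarrow> int) set \<Rightarrow> ('i \<Rightarrow> int) \<Rightarrow> 'i set \<Rightarrow> nat \<Rightarrow> ('i \<Rightarrow> int) \<Rightarrow> bool" where
  "covers A t I 0 x \<longleftrightarrow> (\<forall>i\<in>I. t i \<le> x i)"
| "covers A t I (Suc j) x \<longleftrightarrow> (\<forall>i\<in>I. 0 \<le> x i) \<and> (\<exists>a\<in>A. covers A t I j (\<lambda>i. x i + a i))"

lemma covers_nonneg:
  assumes "covers A t I j x" "\<forall>i\<in>I. 0 \<le> t i" "i \<in> I"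
  shows "0 \<le> x i"
  using assms by (cases j) force+

lemma covers_subset:
  assumes "covers A t I j x" "J \<subseteq> I"
  shows "covers A t J j x"
  using assms
proof (induction j arbitrary: x)
  case 0
  then show ?case by auto
next
  case (Suc j)
  then obtain a where "a \<in> A" "covers A t J j (\<lambda>i. x i + a i)" by auto
  with Suc.prems show ?case by auto
qed

lemma covers_cong:
  assumes "covers A t I j x" "\<forall>i\<in>I. x i = y i"
  shows "covers A t I j y"
  using assms
proof (induction j arbitrary: x y)
  case (Suc j)
  then obtain a where "a \<in> A" "covers A t I j (\<lambda>i. x i + a i)" by auto
  moreover from this have "covers A t I j (\<lambda>i. y i + a i)"
    using Suc.IH[of "\<lambda>i. x i + a i" "\<lambda>i. y i + a i"] Suc.prems by simp
  ultimately show ?case using Suc.prems by auto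
qed simp

text \<open>In \<open>j\<close> steps a coordinate drops by at most \<open>N * j\<close>. One that
  starts at \<open>N * (j + 1)\<close> or more thus stays nonnegative and ends at \<open>N\<close>
  or more, hence above \<open>t\<close>.\<close>

lemma covers_extend:
  assumes "covers A t J j x"
    and "\<forall>a\<in>A. \<forall>i\<in>I. \<bar>a i\<bar> \<le> N" and "\<forall>i\<in>I. t i \<le> N" and "0 \<le> N"
    and "\<forall>i\<in>I - J. N * (int j + 1) \<le> x i"
  shows "covers A t I j x"
  using assms(1,5)
proof (induction j arbitrary: x)
  case 0
  then show ?case using assms(3) by force
next
  case (Suc j)
  then obtain a where a: "a \<in> A" "covers A t J j (\<lambda>i. x i + a i)" by auto
  have "N * (int j + 1) \<le> x i + a i" if "i \<in> I - J" for i
  proof -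
    have "N * (int j + 1) + N \<le> x i" using Suc.prems(2) that by (auto simp: algebra_simps)
    moreover have "\<bar>a i\<bar> \<le> N" using assms(2) a that by auto
    ultimately show ?thesis by linarith
  qed
  then have "covers A t I j (\<lambda>i. x i + a i)" using Suc.IH a by auto
  moreover have "0 \<le> x i" if "i \<in> I" for i
  proof (cases "i \<in> J")
    case True
    then show ?thesis using Suc.prems(1) by auto
  next
    case False
    then have "N * (int (Suc j) + 1) \<le> x i" using Suc.prems(2) that by auto
    moreover have "0 \<le> N * (int (Suc j) + 1)" using assms(4) by simp
    ultimately show ?thesis by linarith
  qed
  ultimately show ?case using a by auto
qed

section \<open>Lengths of shortest covering runs\<close>

text \<open>A relation, since a configuration that cannot cover \<open>t\<close> has no
  distance.\<close>

definition distance :: "('i \<Rightarrow> int) set \<Rightarrow> ('i \<Rightarrow> int) \<Rightarrow> 'i set \<Rightarrow> nat \<Rightarrow> ('i \<Rightarrow> int) \<Rightarrow> bool" where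
  "distance A t I r x \<longleftrightarrow> covers A t I r x \<and> (\<forall>s<r. \<not> covers A t I s x)"

lemma distance_exists:
  assumes "covers A t I j x"
  shows "\<exists>r\<le>j. distance A t I r x"
proof (intro exI conjI)
  show "(LEAST r. covers A t I r x) \<le> j" using assms by (rule Least_le)
  show "distance A t I (LEAST r. covers A t I r x) x"
    unfolding distance_def using LeastI[of "\<lambda>r. covers A t I r x", OF assms] not_less_Least by blast
qed

text \<open>Take the second configuration of a shortest run: a shorter run from it would shorten the
  run from \<open>x\<close>.\<close>

lemma distance_pred:
  assumes "distance A t I (Suc r) x"
  shows "\<exists>y. distance A t I r y"
proof -
  from assms obtain a where a: "a \<in> A" "covers A t I r (\<lambda>i. x i + a i)" "\<forall>i\<in>I. 0 \<le> x i"
    unfolding distance_def by auto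
  have "\<not> covers A t I s (\<lambda>i. x i + a i)" if "s < r" for s
  proof
    assume "covers A t I s (\<lambda>i. x i + a i)"
    with a have "covers A t I (Suc s) x" by auto
    with assms that show False unfolding distance_def by (meson Suc_less_eq)
  qed
  with a show ?thesis unfolding distance_def by blast
qed

lemma distance_le_exists:
  assumes "distance A t I l x" "r \<le> l"
  shows "\<exists>y. distance A t I r y"
  using assms
proof (induction l arbitrary: x)
  case 0
  then show ?case by auto
next
  case (Suc l)
  then show ?case using distance_pred[of A t I l x] by (auto simp: le_Suc_eq)
qed

text \<open>Covering depends only on the coordinates in \<open>I\<close>. This later makes
  configurations at different distances distinct on \<open>I\<close>.\<close>

lemma distance_unique:
  assumes "distance A t I r x" "distance A t I s y" "\<forall>i\<in>I. x i = y i"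
  shows "r = s"
proof -
  have "covers A t I s x" "covers A t I r y"
    using assms covers_cong[of A t I s y x] covers_cong[of A t I r x y]
    unfolding distance_def by auto
  then show ?thesis using assms unfolding distance_def by (meson linorder_neqE_nat)
qed

section \<open>Counting thin configurations\<close>

text \<open>Equivalently, after sorting the coordinates increasingly and counting from 0, the one at
  position k is below \<open>M k\<close>. Extensionality fixes the values outside \<open>I\<close>,
  so that the set can be finite.\<close>

definition thin :: "(nat \<Rightarrow> nat) \<Rightarrow> 'i set \<Rightarrow> ('i \<Rightarrow> int) set" where
  "thin M I = {v \<in> I \<rightarrow>\<^sub>E {0..}. \<forall>k<card I. k < card {i \<in> I. v i < int (M k)}}"

text \<open>If the maximum is below \<open>M k\<close>, so are all remaining coordinates, and there
  are more than k of them. Otherwise \<open>i\<close> was not counted, and removing it leaves the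
  count unchanged.\<close>

lemma thin_remove_max:
  assumes "finite I" "v \<in> thin M I" "i \<in> I" "\<forall>j\<in>I. v j \<le> v i"
  shows "restrict v (I - {i}) \<in> thin M (I - {i})"
proof -
  have "k < card {j \<in> I - {i}. restrict v (I - {i}) j < int (M k)}"
    if k: "k < card (I - {i})" for k
  proof (cases "v i < int (M k)")
    case True
    with assms(4) have "{j \<in> I - {i}. restrict v (I - {i}) j < int (M k)} = I - {i}"
      by fastforce
    with k show ?thesis by simp
  next
    case False
    then have "{j \<in> I - {i}. restrict v (I - {i}) j < int (M k)} = {j \<in> I. v j < int (M k)}"
      by auto
    moreover have "k < card I" using k assms by simp
    ultimately show ?thesis using assms(2) unfolding thin_def by simp
  qed
  with assms(2) show ?thesis unfolding thin_def by auto
qed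

text \<open>A thin vector on m + 1 coordinates is determined by the position of a maximum, its value
  below \<open>M m\<close>, and a thin vector on the rest. This yields the factor
  \<open>Suc m * M m\<close>.\<close>

lemma finite_card_thin:
  assumes "finite I"
  shows "finite (thin M I) \<and> card (thin M I) \<le> (\<Prod>k<card I. Suc k * M k)"
  using assms
proof (induction "card I" arbitrary: I)
  case 0
  then have "thin M I = {\<lambda>_. undefined}" unfolding thin_def by auto
  then show ?case using 0 by simp
next
  case (Suc m)
  define P where "P = (\<Prod>k<m. Suc k * M k)"
  define f where "f = (\<lambda>i (c, w :: 'a \<Rightarrow> int). w(i := c))"
  define S where "S = (\<lambda>i. f i ` ({0..<int (M m)} \<times> thin M (I - {i})))"
  have S: "finite (S i) \<and> card (S i) \<le> M m * P" if "i \<in> I" for i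
  proof -
    have "m = card (I - {i})" using Suc that by simp
    then have ih: "finite (thin M (I - {i}))" "card (thin M (I - {i})) \<le> P"
      using Suc.hyps(1)[of "I - {i}"] Suc.prems unfolding P_def by auto
    have "card (S i) \<le> card ({0..<int (M m)} \<times> thin M (I - {i}))"
      unfolding S_def using ih by (intro card_image_le) simp
    also have "\<dots> \<le> M m * P" using ih by (simp add: card_cartesian_product)
    finally show ?thesis using ih unfolding S_def by simp
  qed
  have sub: "thin M I \<subseteq> (\<Union>i\<in>I. S i)"
  proof
    fix v assume v: "v \<in> thin M I"
    have "I \<noteq> {}" using Suc by auto
    then have "Max (v ` I) \<in> v ` I" using Suc.prems by simp
    then obtain i where i: "i \<in> I" "v i = Max (v ` I)" by force
    then have max: "\<forall>j\<in>I. v j \<le> v i" using Suc.prems by simp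
    \<comment> \<open>The condition for the last index says that all m + 1 coordinates are below
      \<open>M m\<close>.\<close>
    have "m < card {j \<in> I. v j < int (M m)}" using v Suc.hyps(2) unfolding thin_def by auto
    then have "card {j \<in> I. v j < int (M m)} \<ge> card I" using Suc.hyps(2) by simp
    then have "{j \<in> I. v j < int (M m)} = I"
      by (intro card_seteq) (use Suc.prems in auto)
    then have "v i < int (M m)" using i(1) by blast
    moreover have "0 \<le> v i" using i(1) v unfolding thin_def by blast
    moreover have "v = f i (v i, restrict v (I - {i}))"
      using v i unfolding thin_def f_def by (auto simp: fun_eq_iff PiE_def extensional_def)
    ultimately have "v \<in> S i"
      unfolding S_def using thin_remove_max[OF Suc.prems v i(1) max] by force
    with i show "v \<in> (\<Union>i\<in>I. S i)" by auto
  qed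
  have fin: "finite (\<Union>i\<in>I. S i)" using S Suc.prems by auto
  have "card (thin M I) \<le> card (\<Union>i\<in>I. S i)" using card_mono[OF fin sub] .
  also have "\<dots> \<le> (\<Sum>i\<in>I. card (S i))" by (rule card_UN_le[OF Suc.prems])
  also have "\<dots> \<le> (\<Sum>i\<in>I. M m * P)" using S by (intro sum_mono) auto
  also have "\<dots> = Suc m * M m * P" using Suc.hyps(2) by simp
  also have "\<dots> = (\<Prod>k<card I. Suc k * M k)"
    unfolding P_def using Suc.hyps(2)[symmetric] by (simp add: mult.commute)
  finally show ?case using finite_subset[OF sub fin] by auto
qed

section \<open>Exponents of the length bound\<close>

text \<open>The function \<open>len_exp\<close> solves \<open>len_exp m = 1 + (\<Sum>k<m. len_exp k + 3)\<close>: a summand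
  \<open>len_exp k + 3\<close> comes from the factor \<open>Suc k * M k\<close> in the number of thin vectors, where
  \<open>M k = n ^ (len_exp k + 2)\<close>.\<close>
definition len_exp :: "nat \<Rightarrow> nat" where
  "len_exp m = 2 ^ (m + 2) - 3"

lemma four_le_two_power: "4 \<le> (2::nat) ^ (m + 2)"
  using power_increasing[of 2 "m + 2" "2::nat"] by simp

lemma len_exp_add_3: "len_exp m + 3 = 2 ^ (m + 2)"
  unfolding len_exp_def
  by (rule le_add_diff_inverse2, rule order_trans[OF _ four_le_two_power]) simp

lemma len_exp_pos: "1 \<le> len_exp m"
  using len_exp_add_3[of m] four_le_two_power[of m] by linarith

lemma len_exp_Suc: "len_exp (Suc m) = 2 * len_exp m + 3"
  using len_exp_add_3[of m] len_exp_add_3[of "Suc m"] by simp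

lemma len_exp_mono: "k \<le> m \<Longrightarrow> len_exp k \<le> len_exp m"
  unfolding len_exp_def by (intro diff_le_mono power_increasing) auto

text \<open>Each \<open>Suc k\<close> is at most \<open>n\<close> and costs one more power. The
  power left over by \<open>len_exp m - 1\<close> later absorbs a factor 2.\<close>

lemma thin_product_le:
  fixes n :: nat
  assumes "m \<le> n"
  shows "(\<Prod>k<m. Suc k * n ^ (len_exp k + 2)) \<le> n ^ (len_exp m - 1)"
  using assms
proof (induction m)
  case 0
  then show ?case by (simp add: len_exp_def)
next
  case (Suc m)
  have "(\<Prod>k<Suc m. Suc k * n ^ (len_exp k + 2)) \<le> n ^ (len_exp m - 1) * (n * n ^ (len_exp m + 2))"
    unfolding prod.lessThan_Suc using Suc by (intro mult_mono) auto
  also have "\<dots> = n ^ (len_exp m - 1 + Suc (len_exp m + 2))" by (simp only: power_add power_Suc)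
  also have "len_exp m - 1 + Suc (len_exp m + 2) = len_exp (Suc m) - 1"
    using len_exp_pos[of m] len_exp_Suc[of m] by simp
  finally show ?case .
qed

section \<open>The length bound, by induction on the number of coordinates\<close>

lemma distance_le:
  fixes n :: nat
  assumes "finite I" "card I \<le> n" "2 \<le> n"
    and A: "\<forall>a\<in>A. \<forall>i\<in>I. \<bar>a i\<bar> \<le> int n" and t: "\<forall>i\<in>I. 0 \<le> t i \<and> t i \<le> int n"
    and "distance A t I l x"
  shows "l \<le> n ^ len_exp (card I)"
  using assms(1,2,4-6)
proof (induction "card I" arbitrary: I l x rule: less_induct)
  case less
  note A = less.prems(3) and t = less.prems(4)
  show ?case
  proof (cases "card I")
    case 0
    then have "I = {}" using less.prems by simp
    then have "covers A t I 0 x" by simp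
    then have "l = 0" using less.prems(5) unfolding distance_def by blast
    then show ?thesis by simp
  next
    case (Suc m)
    \<comment> \<open>Surviving s steps takes \<open>n * (s + 1)\<close>; for
      \<open>s \<le> n ^ len_exp k\<close> this is at most \<open>n * (2 * n ^ len_exp k)\<close>,
      and 2 \<le> n gives two extra powers.\<close>
    define M where "M k = n ^ (len_exp k + 2)" for k
    have "\<exists>y. distance A t I r y" if "r \<le> l" for r
      using distance_le_exists less.prems(5) that by blast
    then obtain y where y: "\<And>r. r \<le> l \<Longrightarrow> distance A t I r (y r)" by metis
    define z where "z r = restrict (y r) I" for r
    have thin: "z r \<in> thin M I" if r: "r \<in> {n ^ len_exp m<..l}" for r
    proof (rule ccontr)
      assume not_thin: "z r \<notin> thin M I"
      have d: "distance A t I r (y r)" using y r by auto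
      then have c: "covers A t I r (y r)" unfolding distance_def by blast
      have "z r \<in> I \<rightarrow>\<^sub>E {0..}" using covers_nonneg[OF c] t unfolding z_def by auto
      then obtain k where k: "k < card I" "card {i \<in> I. z r i < int (M k)} \<le> k"
        using not_thin unfolding thin_def by (auto simp: not_less)
      define J where "J = {i \<in> I. y r i < int (M k)}"
      have "{i \<in> I. z r i < int (M k)} = J" unfolding J_def z_def by auto
      then have J: "card J \<le> k" "J \<subseteq> I" using k unfolding J_def by auto
      \<comment> \<open>Forgetting the large coordinates keeps the run, and \<open>J\<close> is
        smaller than \<open>I\<close>, so the induction hypothesis bounds the distance
        \<open>s\<close> on \<open>J\<close>.\<close>
      have "covers A t J r (y r)" using covers_subset c J by blast
      then obtain s where s: "distance A t J s (y r)" using distance_exists by blast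
      have "s \<le> n ^ len_exp (card J)"
        by (rule less.hyps) (use J k less.prems s finite_subset in auto)
      also have "\<dots> \<le> n ^ len_exp k"
        using len_exp_mono[OF J(1)] assms(3) by (intro power_increasing) auto
      finally have sk: "s \<le> n ^ len_exp k" .
      have "n * (s + 1) \<le> n * (n ^ len_exp k + n ^ len_exp k)"
        using sk assms(3) by (intro mult_mono add_mono) auto
      also have "\<dots> = n * (2 * n ^ len_exp k)" by simp
      also have "\<dots> \<le> n * (n * n ^ len_exp k)" using assms(3) by (intro mult_mono) auto
      also have "\<dots> = M k" unfolding M_def by simp
      finally have "int (n * (s + 1)) \<le> int (M k)" by (simp only: of_nat_le_iff)
      then have "int n * (int s + 1) \<le> int (M k)" by (simp add: algebra_simps)
      then have "\<forall>i\<in>I - J. int n * (int s + 1) \<le> y r i" unfolding J_def by force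
      \<comment> \<open>The large coordinates survive these \<open>s\<close> steps, so
        \<open>y r\<close> is closer to the target than assumed.\<close>
      then have "covers A t I s (y r)"
        using covers_extend[of A t J s "y r" I "int n"] s A t unfolding distance_def by auto
      then have "r \<le> s" using d unfolding distance_def by (meson not_less)
      also note sk
      also have "n ^ len_exp k \<le> n ^ len_exp m"
        using k Suc len_exp_mono[of k m] assms(3) by (intro power_increasing) auto
      finally show False using r by simp
    qed
    have "inj_on z {n ^ len_exp m<..l}"
    proof (rule inj_onI)
      fix r s assume rs: "r \<in> {n ^ len_exp m<..l}" "s \<in> {n ^ len_exp m<..l}" "z r = z s"
      then have "\<forall>i\<in>I. y r i = y s i" unfolding z_def by (metis restrict_apply')
      then show "r = s" using distance_unique[of A t I r "y r" s "y s"] y rs by auto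
    qed
    then have "card {n ^ len_exp m<..l} \<le> card (thin M I)"
      by (rule card_inj_on_le) (use thin finite_card_thin[OF less.prems(1)] in auto)
    also have "\<dots> \<le> n ^ (len_exp (card I) - 1)"
      using finite_card_thin[OF less.prems(1), of M] thin_product_le[OF less.prems(2)]
      unfolding M_def by linarith
    \<comment> \<open>The interval has \<open>l - n ^ len_exp m\<close> elements, one thin vector
      for each large distance.\<close>
    finally have "l \<le> n ^ len_exp m + n ^ (len_exp (card I) - 1)" by simp
    also have "\<dots> \<le> n ^ (len_exp (card I) - 1) + n ^ (len_exp (card I) - 1)"
      using Suc assms(3) len_exp_Suc[of m] by (intro add_right_mono power_increasing) auto
    also have "\<dots> = 2 * n ^ (len_exp (card I) - 1)" by simp
    also have "\<dots> \<le> n * n ^ (len_exp (card I) - 1)" using assms(3) by (intro mult_right_mono) auto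
    also have "\<dots> = n ^ len_exp (card I)"
      using len_exp_pos[of "card I"] by (metis Suc_diff_1 less_eq_Suc_le One_nat_def power_Suc)
    finally show ?thesis .
  qed
qed

section \<open>Transfer to the backward coverability algorithm\<close>

lemma vas_step_covers:
  assumes "vas_step d A x y" "A \<subseteq> carrier_vec d"
    and "covers ((\<lambda>a i. a $ i) ` A) t {..<d} j (\<lambda>i. int (y $ i))"
  shows "covers ((\<lambda>a i. a $ i) ` A) t {..<d} (Suc j) (\<lambda>i. int (x $ i))"
proof -
  from assms(1) obtain a where a: "a \<in> A" "map_vec int y = map_vec int x + a"
    and xy: "x \<in> carrier_vec d" "y \<in> carrier_vec d"
    unfolding vas_step_def by auto
  have "int (y $ i) = int (x $ i) + a $ i" if "i < d" for i
  proof -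
    have "map_vec int y $ i = (map_vec int x + a) $ i" using a by simp
    moreover have "a \<in> carrier_vec d" using a(1) assms(2) by auto
    ultimately show ?thesis using xy that by simp
  qed
  then have "covers ((\<lambda>a i. a $ i) ` A) t {..<d} j (\<lambda>i. int (x $ i) + a $ i)"
    using covers_cong[OF assms(3)] by simp
  then show ?thesis using a by auto
qed

lemma covers_Suc_vas_step:
  assumes "A \<subseteq> carrier_vec d" "x \<in> carrier_vec d" "\<forall>i<d. 0 \<le> t i"
    and "covers ((\<lambda>a i. a $ i) ` A) t {..<d} (Suc j) (\<lambda>i. int (x $ i))"
  obtains y where "vas_step d A x y"
    and "covers ((\<lambda>a i. a $ i) ` A) t {..<d} j (\<lambda>i. int (y $ i))"
proof -
  from assms(4) obtain a
    where a: "a \<in> A" "covers ((\<lambda>a i. a $ i) ` A) t {..<d} j (\<lambda>i. int (x $ i) + a $ i)"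
    by auto
  \<comment> \<open>\<open>nat\<close> truncates nothing: the successor is nonnegative, even at the
    end of the run, because \<open>t\<close> is.\<close>
  define y where "y = vec d (\<lambda>i. nat (int (x $ i) + a $ i))"
  have y: "int (y $ i) = int (x $ i) + a $ i" if "i < d" for i
    using covers_nonneg[OF a(2)] assms(3) that unfolding y_def by auto
  have "map_vec int y = map_vec int x + a"
  proof (rule eq_vecI)
    fix i assume "i < dim_vec (map_vec int x + a)"
    then have "i < d" using a(1) assms(1) by auto
    moreover have "dim_vec y = d" unfolding y_def by simp
    ultimately show "map_vec int y $ i = (map_vec int x + a) $ i"
      using y a(1) assms(1,2) by auto
  qed (use a(1) assms(1) in \<open>auto simp: y_def\<close>)
  then have "vas_step d A x y"
    unfolding vas_step_def using a(1) assms(2) by (auto simp: y_def)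
  moreover have "covers ((\<lambda>a i. a $ i) ` A) t {..<d} j (\<lambda>i. int (y $ i))"
    using covers_cong[OF a(2)] y by simp
  ultimately show ?thesis by (rule that)
qed

lemma backward_cover_iff_covers:
  assumes "A \<subseteq> carrier_vec d" "t \<in> carrier_vec d"
  shows "x \<in> backward_cover d A t l \<longleftrightarrow> x \<in> carrier_vec d \<and>
    (\<exists>j\<le>l. covers ((\<lambda>a i. a $ i) ` A) (\<lambda>i. int (t $ i)) {..<d} j (\<lambda>i. int (x $ i)))"
    (is "_ \<longleftrightarrow> _ \<and> (\<exists>j\<le>l. ?C j x)")
proof (induction l arbitrary: x)
  case 0
  then show ?case using assms(2) by (auto simp: upward_closure_def less_eq_vec_def)
next
  case (Suc l)
  show ?case
  proof
    assume "x \<in> backward_cover d A t (Suc l)"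
    then consider "x \<in> backward_cover d A t l"
      | y where "x \<in> carrier_vec d" "vas_step d A x y" "y \<in> backward_cover d A t l"
      by (auto simp: pre_exists_def)
    then show "x \<in> carrier_vec d \<and> (\<exists>j\<le>Suc l. ?C j x)"
    proof cases
      case 1
      then show ?thesis using Suc.IH le_SucI by blast
    next
      case 2
      then show ?thesis
        using Suc.IH vas_step_covers[OF 2(2) assms(1)] by (meson Suc_le_mono)
    qed
  next
    assume x: "x \<in> carrier_vec d \<and> (\<exists>j\<le>Suc l. ?C j x)"
    then obtain j where j: "j \<le> Suc l" "?C j x" by blast
    show "x \<in> backward_cover d A t (Suc l)"
    proof (cases "j \<le> l")
      case True
      then show ?thesis using x j Suc.IH by auto
    next
      case False
      then have "?C (Suc l) x" using j by (simp add: le_Suc_eq)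
      then obtain y where y: "vas_step d A x y" "?C l y"
        using covers_Suc_vas_step[of A d x "\<lambda>i. int (t $ i)" l] assms(1) x by auto
      then have "y \<in> backward_cover d A t l" using Suc.IH unfolding vas_step_def by blast
      with y x show ?thesis by (auto simp: pre_exists_def)
    qed
  qed
qed

text \<open>The extra symbol per entry of the target is what makes the size bound the
  dimension.\<close>

lemma unary_size_bounds:
  assumes "finite A"
  shows "d \<le> unary_size d A t"
    and "i < d \<Longrightarrow> t $ i \<le> unary_size d A t"
    and "a \<in> A \<Longrightarrow> i < d \<Longrightarrow> \<bar>a $ i\<bar> \<le> int (unary_size d A t)"
proof -
  have "(\<Sum>i<d. 1) \<le> (\<Sum>i<d. t $ i + 1)" by (intro sum_mono) auto
  then show "d \<le> unary_size d A t" unfolding unary_size_def by simp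
  show "t $ i \<le> unary_size d A t" if "i < d"
    using member_le_sum[of i "{..<d}" "\<lambda>i. t $ i + 1"] that unfolding unary_size_def by simp
  show "\<bar>a $ i\<bar> \<le> int (unary_size d A t)" if "a \<in> A" "i < d"
  proof -
    have "nat \<bar>a $ i\<bar> + 1 \<le> (\<Sum>i<d. nat \<bar>a $ i\<bar> + 1)"
      using that by (intro member_le_sum) auto
    also have "\<dots> \<le> (\<Sum>a\<in>A. \<Sum>i<d. nat \<bar>a $ i\<bar> + 1)"
      by (rule member_le_sum) (use that assms in auto)
    finally show ?thesis unfolding unary_size_def by linarith
  qed
qed

text \<open>A configuration in stage \<open>l + 1\<close> covers \<open>t\<close> at all, so its
  shortest run has at most \<open>l\<close> steps and puts it into stage \<open>l\<close>.\<close>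

lemma backward_cover_stable:
  assumes "vas d A" "t \<in> carrier_vec d" "2 \<le> unary_size d A t"
  defines "l \<equiv> unary_size d A t ^ len_exp d"
  shows "backward_cover d A t l = backward_cover d A t (l + 1)"
proof
  show "backward_cover d A t l \<subseteq> backward_cover d A t (l + 1)" by simp
next
  have fin: "finite A" and sub: "A \<subseteq> carrier_vec d" using assms(1) unfolding vas_def by auto
  let ?A = "(\<lambda>a i. a $ i) ` A" and ?t = "\<lambda>i. int (t $ i)"
  show "backward_cover d A t (l + 1) \<subseteq> backward_cover d A t l"
  proof
    fix x assume "x \<in> backward_cover d A t (l + 1)"
    then obtain j where x: "x \<in> carrier_vec d"
      and "covers ?A ?t {..<d} j (\<lambda>i. int (x $ i))"
      using backward_cover_iff_covers[OF sub assms(2)] by blast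
    then obtain r where r: "distance ?A ?t {..<d} r (\<lambda>i. int (x $ i))"
      using distance_exists by blast
    have "r \<le> unary_size d A t ^ len_exp (card {..<d})"
      by (rule distance_le[OF _ _ assms(3) _ _ r])
        (use unary_size_bounds[OF fin] in auto)
    then have "r \<le> l" unfolding l_def by simp
    with x r show "x \<in> backward_cover d A t l"
      using backward_cover_iff_covers[OF sub assms(2)] unfolding distance_def by blast
  qed
qed

theorem theorem4p3:
  shows "\<exists>c::nat. \<forall>d\<ge>2. \<forall>(A :: int vec set) (t :: nat vec) (n :: nat).
    vas d A \<longrightarrow> t \<in> carrier_vec d \<longrightarrow> n = unary_size d A t \<longrightarrow> n \<ge> 2 \<longrightarrow>
      (\<exists>l. backward_cover d A t l = backward_cover d A t (l + 1)) \<and>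
      (LEAST l. backward_cover d A t l = backward_cover d A t (l + 1)) \<le> n ^ (2 ^ (c * d))"
proof (rule exI[of _ 2], intro allI impI)
  fix d n :: nat and A :: "int vec set" and t :: "nat vec"
  assume h: "2 \<le> d" "vas d A" "t \<in> carrier_vec d" "n = unary_size d A t" "2 \<le> n"
  let ?P = "\<lambda>l. backward_cover d A t l = backward_cover d A t (l + 1)"
  have stable: "?P (n ^ len_exp d)" using backward_cover_stable h by blast
  have "len_exp d \<le> 2 ^ (d + 2)" unfolding len_exp_def by simp
  \<comment> \<open>The constant 2 suffices because d + 2 \<le> 2 * d for d \<ge> 2.\<close>
  also have "\<dots> \<le> 2 ^ (2 * d)" using h(1) by (intro power_increasing) auto
  finally have "n ^ len_exp d \<le> n ^ (2 ^ (2 * d))" using h(5) by (intro power_increasing) auto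
  moreover have "(LEAST l. ?P l) \<le> n ^ len_exp d" using stable by (rule Least_le)
  ultimately show "(\<exists>l. ?P l) \<and> (LEAST l. ?P l) \<le> n ^ (2 ^ (2 * d))"
    using stable by (meson order_trans)
qed

end
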